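(* Let $I\subset(0,\infty)$ be an interval, let $f:I\to\mathbb{R}$ be a differentiable function on the interior $I^\circ$ of $I$, let $a,b\in I$ with $a<b$, and let $f'\in L[a,b]$. If $|f'|^q$ is harmonically convex on $[a,b]$ for $q>1$, $\frac1p+\frac1q=1$, then $$\left|\frac{f(a)+f(b)}{2}-\frac{ab}{b-a}\int_a^b\frac{f(x)}{x^2}\,dx\right|\le \frac{ab(b-a)}{2}\left(\frac{1}{p+1}\right)^{\frac1p}\left(\mu_1|f'(a)|^q+\mu_2|f'(b)|^q\right)^{\frac1q},$$ where $$\mu_1=\frac{1}{2(b-a)^2(1-q)(1-2q)}\left[a^{2-2q}+b^{1-2q}\left[(b-a)(1-2q)-a\right]\right],$$ $$\mu_2=\frac{1}{2(b-a)^2(1-q)(1-2q)}\left[b^{2-2q}-a^{1-2q}\left[(b-a)(1-2q)+b\right]\right].$$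
   Context: Let $J\subset\mathbb{R}\setminus\{0\}$ be a real interval. A function $g:J\to\mathbb{R}$ is called harmonically convex on $J$ if $$g\left(\frac{xy}{tx+(1-t)y}\right)\le t g(y)+(1-t)g(x)$$ for all $x,y\in J$ and $t\in[0,1]$. $L[a,b]$ denotes the space of Lebesgue integrable functions on $[a,b]$.
   Formalization: If a or b is an endpoint of I, f is also assumed to have a one-sided derivative there, and f'(a), f'(b) denote it; differentiability on the interior alone leaves these undefined, and the bound fails e.g. for f = 0 on (1,2], f(1) = 1, with f' taken as 0. *)

theory Defs
  imports "HOL-Analysis.Analysis"
begin

definition harmonically_convex_on :: "real set \<Rightarrow> (real \<Rightarrow> real) \<Rightarrow> bool" where
  "harmonically_convex_on J g \<longleftrightarrow>
     is_interval J \<and> 0 \<notin> J \<and>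
     (\<forall>x\<in>J. \<forall>y\<in>J. \<forall>t\<in>{0..1}.
        g (x * y / (t * x + (1 - t) * y)) \<le> t * g y + (1 - t) * g x)"

(* For 0 < a < b and q > 1, mu1 and mu2 are the closed forms of the integrals over t in [0,1] of
   t / (t b + (1 - t) a)^(2 q)  and  (1 - t) / (t b + (1 - t) a)^(2 q). *)

definition mu1 :: "real \<Rightarrow> real \<Rightarrow> real \<Rightarrow> real" where
  "mu1 a b q =
     1 / (2 * (b - a)\<^sup>2 * (1 - q) * (1 - 2 * q)) *
     (a powr (2 - 2 * q) + b powr (1 - 2 * q) * ((b - a) * (1 - 2 * q) - a))"

definition mu2 :: "real \<Rightarrow> real \<Rightarrow> real \<Rightarrow> real" where
  "mu2 a b q =
     1 / (2 * (b - a)\<^sup>2 * (1 - q) * (1 - 2 * q)) *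
     (b powr (2 - 2 * q) - a powr (1 - 2 * q) * ((b - a) * (1 - 2 * q) + b))"

end

theory Submission
  imports Defs
begin

text \<open>Integration by parts against \<open>w(x) = (1/a + 1/b)/2 - 1/x\<close>, an antiderivative of \<open>1/x\<^sup>2\<close> with
  \<open>w(b) = -w(a) = (b - a)/(2ab)\<close>, turns the left-hand side into \<open>ab/(b - a)\<close> times the modulus of
  \<open>\<integral> f' w\<close>. Harmonic convexity bounds \<open>\<bar>f'(x)\<bar>\<^sup>q\<close> by
  \<open>t \<bar>f'(a)\<bar>\<^sup>q + (1 - t) \<bar>f'(b)\<bar>\<^sup>q\<close>, where \<open>x = ab/(tb + (1 - t)a)\<close>, that is
  \<open>t = a(b - x)/(x(b - a))\<close>. As this bound is continuous in \<open>x\<close>, a Hoelder inequality for continuous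
  functions with respect to \<open>dx/x\<^sup>2\<close> suffices, and the two remaining integrals are elementary.\<close>

text \<open>Young's inequality is applied pointwise to \<open>u\<close> and \<open>v\<close> divided
  by their p- and q-norms; integrating it leaves \<open>1 / p + 1 / q = 1\<close> on the right.
  Continuity supplies every integrability needed.\<close>

lemma Holder_continuous_on:
  fixes u v :: "real \<Rightarrow> real"
  assumes "a < b" and u: "continuous_on {a..b} u" and v: "continuous_on {a..b} v"
    and u0: "\<And>x. x \<in> {a..b} \<Longrightarrow> 0 \<le> u x" and v0: "\<And>x. x \<in> {a..b} \<Longrightarrow> 0 \<le> v x"
    and pq: "p > 1" "q > 1" "1 / p + 1 / q = 1"
  shows "integral {a..b} (\<lambda>x. u x * v x) \<le>
    integral {a..b} (\<lambda>x. u x powr p) powr (1 / p) * integral {a..b} (\<lambda>x. v x powr q) powr (1 / q)"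
proof -
  define P where "P = integral {a..b} (\<lambda>x. u x powr p)"
  define Q where "Q = integral {a..b} (\<lambda>x. v x powr q)"
  have cu: "continuous_on {a..b} (\<lambda>x. u x powr p)" and cv: "continuous_on {a..b} (\<lambda>x. v x powr q)"
    using u v u0 v0 pq by (auto intro!: continuous_on_powr')
  note iu = integrable_continuous_real[OF cu] and iv = integrable_continuous_real[OF cv]
  have nonneg: "P \<ge> 0" "Q \<ge> 0"
    unfolding P_def Q_def by (auto intro!: integral_nonneg iu iv)
  show ?thesis
  proof (cases "P = 0 \<or> Q = 0")
    case True
    \<comment> \<open>A nonnegative continuous function with integral 0 vanishes everywhere, so one
      of the two factors is identically 0.\<close>
    then have "\<forall>x\<in>{a..b}. u x * v x = 0"
      using integral_eq_0_iff[OF cu \<open>a < b\<close>] integral_eq_0_iff[OF cv \<open>a < b\<close>]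
      by (auto simp: P_def Q_def)
    then have "integral {a..b} (\<lambda>x. u x * v x) = integral {a..b} (\<lambda>x. 0)"
      by (intro integral_cong) auto
    then show ?thesis by simp
  next
    case False
    with nonneg have pos: "P > 0" "Q > 0" by auto
    define r where "r = P powr (1 / p)"
    define s where "s = Q powr (1 / q)"
    have rs: "r > 0" "s > 0" "r powr p = P" "s powr q = Q"
      using pos pq by (auto simp: r_def s_def powr_powr)
    have young: "u x * v x / (r * s) \<le> u x powr p / (P * p) + v x powr q / (Q * q)"
      if "x \<in> {a..b}" for x
      using Youngs_inequality[OF pq, of "u x / r" "v x / s"] rs u0[OF that] v0[OF that]
      by (simp add: powr_divide)
    have "integral {a..b} (\<lambda>x. u x * v x) / (r * s) = integral {a..b} (\<lambda>x. u x * v x / (r * s))"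
      by simp
    also have "\<dots> \<le> integral {a..b} (\<lambda>x. u x powr p / (P * p) + v x powr q / (Q * q))"
      by (intro integral_le young integrable_add integrable_on_divide iu iv
          integrable_continuous_real[OF continuous_on_mult] u v)
    also have "\<dots> = P / (P * p) + Q / (Q * q)"
      unfolding P_def Q_def
      by (simp add: integral_add integrable_on_divide iu iv)
    also have "\<dots> = 1" using pos pq by simp
    finally show ?thesis
      using rs unfolding r_def s_def P_def Q_def by (simp add: pos_divide_le_eq)
  qed
qed

lemma has_real_derivative_abs:
  fixes x :: real
  assumes "x \<noteq> 0"
  shows "(abs has_real_derivative sgn x) (at x)"
proof (cases "x > 0")
  case True
  show ?thesis
    by (rule has_field_derivative_transform_within_open[where f = "\<lambda>x. x" and S = "{0<..}"])
      (use True in auto)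
next
  case False
  show ?thesis
    by (rule has_field_derivative_transform_within_open[where f = "\<lambda>x. - x" and S = "{..<0}"])
      (use False assms in \<open>auto intro!: derivative_eq_intros\<close>)
qed

text \<open>Since \<open>w' = 1 / x^2\<close>, the function \<open>w * |w|^p / (p + 1)\<close> is an
  antiderivative on both sides of the zero of \<open>w\<close>, so the interval need not be split.
  With \<open>w b = h = - w a\<close> the integral is \<open>2 * h * h^p / (p + 1)\<close>.\<close>

lemma has_integral_abs_weight_powr:
  fixes a b p :: real
  assumes "0 < a" "a < b" "p > 0"
  shows "((\<lambda>x. \<bar>(1 / a + 1 / b) / 2 - 1 / x\<bar> powr p / x\<^sup>2) has_integral
    (b - a) / (a * b) * ((b - a) / (2 * a * b)) powr p / (p + 1)) {a..b}"
proof -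
  define w where "w = (\<lambda>x. (1 / a + 1 / b) / 2 - 1 / x)"
  define F where "F = (\<lambda>x. w x * \<bar>w x\<bar> powr p / (p + 1))"
  have contw: "continuous_on {a..b} w"
    unfolding w_def using assms by (auto intro!: continuous_intros)
  have contF: "continuous_on {a..b} F"
    unfolding F_def using assms by (auto intro!: continuous_intros contw continuous_on_powr')
  \<comment> \<open>The excluded point, the harmonic mean of \<open>a\<close> and \<open>b\<close>,
    is the only zero of \<open>w\<close>, where the chain rule through \<open>abs\<close> fails. The
    fundamental theorem tolerates it because \<open>F\<close> is continuous.\<close>
  have deriv: "(F has_vector_derivative \<bar>w x\<bar> powr p / x\<^sup>2) (at x)"
    if x: "x \<in> {a<..<b} - {2 * a * b / (a + b)}" for x
  proof -
    have "x > 0" using x assms by auto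
    have "w x \<noteq> 0"
      using x assms \<open>x > 0\<close> by (auto simp: w_def field_simps)
    have dw: "(w has_real_derivative 1 / x\<^sup>2) (at x)"
      unfolding w_def using \<open>x > 0\<close> by (auto intro!: derivative_eq_intros simp: power2_eq_square)
    have "((\<lambda>x. \<bar>w x\<bar> powr p) has_real_derivative p * \<bar>w x\<bar> powr (p - 1) * (sgn (w x) / x\<^sup>2)) (at x)"
      using DERIV_chain2[OF has_real_derivative_powr
          DERIV_chain2[OF has_real_derivative_abs dw], of p] \<open>w x \<noteq> 0\<close> by simp
    then have "(F has_real_derivative
        (1 / x\<^sup>2 * \<bar>w x\<bar> powr p + p * \<bar>w x\<bar> powr (p - 1) * (sgn (w x) / x\<^sup>2) * w x) / (p + 1)) (at x)"
      unfolding F_def by (intro DERIV_cdivide DERIV_mult dw)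
    moreover have "\<bar>w x\<bar> powr (p - 1) * (sgn (w x) * w x) = \<bar>w x\<bar> powr p"
      using \<open>w x \<noteq> 0\<close> by (simp add: powr_diff sgn_if)
    then have "1 / x\<^sup>2 * \<bar>w x\<bar> powr p + p * \<bar>w x\<bar> powr (p - 1) * (sgn (w x) / x\<^sup>2) * w x
        = (p + 1) * (\<bar>w x\<bar> powr p / x\<^sup>2)"
      by (simp add: algebra_simps add_divide_distrib)
    ultimately show ?thesis
      using assms by (simp add: has_real_derivative_iff_has_vector_derivative)
  qed
  have "((\<lambda>x. \<bar>w x\<bar> powr p / x\<^sup>2) has_integral F b - F a) {a..b}"
    by (rule fundamental_theorem_of_calculus_interior_strong
        [where S = "{2 * a * b / (a + b)}", OF _ _ deriv contF]) (use assms in auto)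
  moreover define h where "h = (b - a) / (2 * a * b)"
  have wb: "w b = h" "w a = - h" and h: "(b - a) / (a * b) = 2 * h" "h > 0"
    using assms by (auto simp: w_def h_def field_simps)
  have "F b - F a = (b - a) / (a * b) * ((b - a) / (2 * a * b)) powr p / (p + 1)"
    unfolding F_def wb h_def[symmetric] h(1) using h(2) by (simp add: add_divide_distrib)
  ultimately show ?thesis by (simp add: w_def)
qed

text \<open>With \<open>x = a * b / (t * b + (1 - t) * a)\<close> one has
  \<open>- dx / x^2 = (b - a) / (a * b) dt\<close>, and the first factors of the integrands are
  \<open>t\<close> and \<open>1 - t\<close>. Hence these are the integrals over \<open>t\<close> in
  [0,1] behind \<open>mu1\<close> and \<open>mu2\<close>, up to the displayed factor. The proof
  evaluates them in the variable \<open>x\<close>.\<close>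

lemma has_integral_mu:
  fixes a b q :: real
  assumes "0 < a" "a < b" "q > 1"
  shows has_integral_mu1: "((\<lambda>x. a * (b - x) / (x * (b - a)) * x powr (2 * q - 2)) has_integral
      (b - a) / (a * b) * (a * b) powr (2 * q) * mu1 a b q) {a..b}"
    and has_integral_mu2: "((\<lambda>x. b * (x - a) / (x * (b - a)) * x powr (2 * q - 2)) has_integral
      (b - a) / (a * b) * (a * b) powr (2 * q) * mu2 a b q) {a..b}"
proof -
  \<comment> \<open>Both integrands are constant multiples of
    \<open>(c - x) / x * x powr (2 * q - 2)\<close>, with \<open>c = b\<close> and
    \<open>c = a\<close> respectively; \<open>F c\<close> is an antiderivative of this
    function.\<close>
  define F where "F = (\<lambda>c x. c * x powr (2 * q - 2) / (2 * q - 2) - x powr (2 * q - 1) / (2 * q - 1))"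
  have F: "((\<lambda>x. (c - x) / x * x powr (2 * q - 2)) has_integral F c b - F c a) {a..b}" for c
  proof (rule fundamental_theorem_of_calculus)
    fix x assume x: "x \<in> {a..b}"
    then have "x > 0" using assms by auto
    have "(F c has_real_derivative
        c * ((2 * q - 2) * x powr (2 * q - 2 - 1)) / (2 * q - 2)
          - (2 * q - 1) * x powr (2 * q - 1 - 1) / (2 * q - 1)) (at x)"
      unfolding F_def using \<open>x > 0\<close>
      by (intro DERIV_diff DERIV_cdivide DERIV_cmult has_real_derivative_powr)
    moreover have "c * ((2 * q - 2) * x powr (2 * q - 2 - 1)) / (2 * q - 2)
          - (2 * q - 1) * x powr (2 * q - 1 - 1) / (2 * q - 1) = (c - x) / x * x powr (2 * q - 2)"
    proof -
      have "x powr (2 * q - 2 - 1) = x powr (2 * q - 2) / x"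
        using \<open>x > 0\<close> by (subst powr_diff) auto
      moreover have "2 * q - 1 - 1 = 2 * q - 2" "2 * q - 2 \<noteq> 0" "2 * q - 1 \<noteq> 0"
        using assms by auto
      ultimately have "c * ((2 * q - 2) * x powr (2 * q - 2 - 1)) / (2 * q - 2) = c * (x powr (2 * q - 2) / x)"
        "(2 * q - 1) * x powr (2 * q - 1 - 1) / (2 * q - 1) = x powr (2 * q - 2)"
        by (metis mult.left_commute nonzero_mult_div_cancel_left)+
      then show ?thesis using \<open>x > 0\<close> by (simp add: diff_divide_distrib left_diff_distrib)
    qed
    ultimately show "(F c has_vector_derivative (c - x) / x * x powr (2 * q - 2)) (at x within {a..b})"
      by (metis has_real_derivative_iff_has_vector_derivative has_vector_derivative_at_within)
  qed (use assms in auto)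
  \<comment> \<open>Once every power is a rational expression in \<open>a\<close>, \<open>b\<close>,
    \<open>A\<close> and \<open>B\<close>, comparison with the closed forms is an identity of
    rational functions.\<close>
  define A where "A = a powr (2 * q)"
  define B where "B = b powr (2 * q)"
  have AB: "A > 0" "B > 0" using assms by (auto simp: A_def B_def)
  have powrs: "a powr (2 * q - 2) = A / a\<^sup>2" "b powr (2 * q - 2) = B / b\<^sup>2"
    "a powr (2 * q - 1) = A / a" "b powr (2 * q - 1) = B / b"
    "a powr (2 - 2 * q) = a\<^sup>2 / A" "b powr (2 - 2 * q) = b\<^sup>2 / B"
    "a powr (1 - 2 * q) = a / A" "b powr (1 - 2 * q) = b / B" "(a * b) powr (2 * q) = A * B"
    using assms by (auto simp: A_def B_def powr_diff powr_mult)
  \<comment> \<open>In terms of \<open>r\<close> and \<open>s\<close> all denominators have a known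
    sign, so they can be cleared.\<close>
  define r where "r = b - a"
  define s where "s = q - 1"
  have rs: "r > 0" "s > 0" "b = a + r" "q = s + 1" using assms by (auto simp: r_def s_def)
  have D: "2 * q - 2 = 2 * s" "2 * q - 1 = 2 * s + 1" "1 - q = - s" "1 - 2 * q = - (2 * s + 1)"
    using rs by auto
  have s1: "2 * s + 1 > 0" using rs by auto
  have "a / (b - a) * (F b b - F b a) = (b - a) / (a * b) * (a * b) powr (2 * q) * mu1 a b q"
    unfolding F_def mu1_def powrs unfolding D r_def[symmetric] using assms(1,2) AB rs(1,2) s1
    apply (simp add: divide_simps power2_eq_square)
    apply (simp add: rs algebra_simps)
    done
  with has_integral_mult_right[OF F[of b], of "a / (b - a)"]
  show "((\<lambda>x. a * (b - x) / (x * (b - a)) * x powr (2 * q - 2)) has_integral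
      (b - a) / (a * b) * (a * b) powr (2 * q) * mu1 a b q) {a..b}"
    by (simp add: mult_ac)
  have "- b / (b - a) * (F a b - F a a) = (b - a) / (a * b) * (a * b) powr (2 * q) * mu2 a b q"
    unfolding F_def mu2_def powrs unfolding D r_def[symmetric] using assms(1,2) AB rs(1,2) s1
    apply (simp add: divide_simps power2_eq_square)
    apply (simp add: rs algebra_simps)
    done
  moreover have "(\<lambda>x. - b / (b - a) * ((a - x) / x * x powr (2 * q - 2)))
      = (\<lambda>x. b * (x - a) / (x * (b - a)) * x powr (2 * q - 2))"
    by (rule ext) (simp add: divide_simps, simp add: algebra_simps)
  ultimately show "((\<lambda>x. b * (x - a) / (x * (b - a)) * x powr (2 * q - 2)) has_integral
      (b - a) / (a * b) * (a * b) powr (2 * q) * mu2 a b q) {a..b}"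
    using has_integral_mult_right[OF F[of a], of "- b / (b - a)"] by metis
qed

text \<open>The derivative of \<open>f * w\<close> is integrable by the fundamental theorem;
  subtracting the continuous function \<open>f x / x^2\<close> yields both the integrability of
  \<open>f' * w\<close> and its integral.\<close>

lemma trapezoid_parts_inverse_square:
  fixes f f' :: "real \<Rightarrow> real"
  assumes "0 < a" "a < b"
    and f': "\<And>x. x \<in> {a..b} \<Longrightarrow> (f has_real_derivative f' x) (at x within {a..b})"
  shows "((\<lambda>x. f' x * ((1 / a + 1 / b) / 2 - 1 / x)) has_integral
    (b - a) / (a * b) * ((f a + f b) / 2) - integral {a..b} (\<lambda>x. f x / x\<^sup>2)) {a..b}"
proof -
  define w where "w = (\<lambda>x. (1 / a + 1 / b) / 2 - 1 / x)"
  have contf: "continuous_on {a..b} f"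
    using f' by (rule DERIV_continuous_on)
  have 1: "((\<lambda>x. f' x * w x + 1 / x\<^sup>2 * f x) has_integral f b * w b - f a * w a) {a..b}"
  proof (rule fundamental_theorem_of_calculus)
    fix x assume x: "x \<in> {a..b}"
    then have "(w has_real_derivative 1 / x\<^sup>2) (at x within {a..b})"
      unfolding w_def using assms by (auto intro!: derivative_eq_intros simp: power2_eq_square)
    from DERIV_mult[OF f'[OF x] this]
    show "((\<lambda>x. f x * w x) has_vector_derivative f' x * w x + 1 / x\<^sup>2 * f x) (at x within {a..b})"
      by (simp add: has_real_derivative_iff_has_vector_derivative)
  qed (use assms in auto)
  have 2: "((\<lambda>x. f x / x\<^sup>2) has_integral integral {a..b} (\<lambda>x. f x / x\<^sup>2)) {a..b}"
    using assms
    by (intro integrable_integral integrable_continuous_real) (auto intro!: continuous_intros contf)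
  have "((\<lambda>x. f' x * w x) has_integral
      f b * w b - f a * w a - integral {a..b} (\<lambda>x. f x / x\<^sup>2)) {a..b}"
    using has_integral_diff[OF 1 2] by simp
  moreover have "f b * w b - f a * w a = (b - a) / (a * b) * ((f a + f b) / 2)"
    using assms by (simp add: w_def field_simps)
  ultimately show ?thesis by (simp add: w_def)
qed

lemma harmonically_convex_on_endpoint_bound:
  assumes "harmonically_convex_on {a..b} g" "0 < a" "a < b" "x \<in> {a..b}"
  shows "g x \<le> a * (b - x) / (x * (b - a)) * g a + b * (x - a) / (x * (b - a)) * g b"
proof -
  define t where "t = a * (b - x) / (x * (b - a))"
  have x: "0 < x" "a \<le> x" "x \<le> b" using assms by auto
  have t': "1 - t = b * (x - a) / (x * (b - a))"
    using assms x by (simp add: t_def divide_simps) (simp add: algebra_simps)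
  have "t \<ge> 0"
    using assms x by (simp add: t_def)
  moreover have "1 - t \<ge> 0"
    unfolding t' using assms x by simp
  \<comment> \<open>The definition is used with \<open>b\<close> in the first place and
    \<open>a\<close> in the second, which pairs \<open>t\<close> with \<open>g a\<close>.\<close>
  ultimately have "g (b * a / (t * b + (1 - t) * a)) \<le> t * g a + (1 - t) * g b"
    using assms unfolding harmonically_convex_on_def by auto
  moreover have "t * (b - a) = a * (b - x) / x"
    using assms x by (simp add: t_def)
  then have "t * b + (1 - t) * a = a * b / x"
    using x by (simp add: algebra_simps diff_divide_distrib)
  then have "b * a / (t * b + (1 - t) * a) = x"
    using assms x by simp
  ultimately have "g x \<le> t * g a + (1 - t) * g b"
    by simp
  then show ?thesis
    unfolding t' unfolding t_def .
qed

theorem theorem3: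
  fixes I :: "real set" and f f' :: "real \<Rightarrow> real" and a b p q :: real
  assumes "is_interval I" and "I \<subseteq> {0<..}"
    and "f differentiable_on interior I"
    and "a \<in> I" and "b \<in> I" and "a < b"
    and "\<And>x. x \<in> {a..b} \<Longrightarrow> (f has_real_derivative f' x) (at x within I)"
    and "f' absolutely_integrable_on {a..b}"
    and "q > 1" and "1 / p + 1 / q = 1"
    and "harmonically_convex_on {a..b} (\<lambda>x. \<bar>f' x\<bar> powr q)"
  shows "\<bar>(f a + f b) / 2 - a * b / (b - a) * integral {a..b} (\<lambda>x. f x / x\<^sup>2)\<bar>
    \<le> a * b * (b - a) / 2 * (1 / (p + 1)) powr (1 / p) *
       (mu1 a b q * \<bar>f' a\<bar> powr q + mu2 a b q * \<bar>f' b\<bar> powr q) powr (1 / q)"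
proof -
  have ab: "0 < a" "a < b" using assms by auto
  have p_eq: "1 / p = 1 - 1 / q" using assms by simp
  moreover have "1 / q < 1" "1 / q > 0" using \<open>q > 1\<close> by auto
  ultimately have "1 / p > 0" "1 / p < 1" by linarith+
  then have "p > 1" by (simp add: divide_less_eq_1)
  have qp: "q / p = q - 1"
    using arg_cong[OF p_eq, of "\<lambda>y. q * y"] \<open>q > 1\<close> by (simp add: right_diff_distrib)
  define w where "w = (\<lambda>x. (1 / a + 1 / b) / 2 - 1 / x)"
  define J where "J = integral {a..b} (\<lambda>x. f x / x\<^sup>2)"
  \<comment> \<open>\<open>d\<close> is the integral of \<open>1 / x^2\<close> over
    \<open>{a..b}\<close>. The inequality is proved multiplied by \<open>d\<close>, and
    \<open>d\<close> is cancelled at the end.\<close>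
  define d where "d = (b - a) / (a * b)"
  have "d > 0" using ab by (simp add: d_def)
  define M where "M = mu1 a b q * \<bar>f' a\<bar> powr q + mu2 a b q * \<bar>f' b\<bar> powr q"
  \<comment> \<open>The majorant of \<open>|f'|^q\<close> from harmonic convexity. It replaces
    \<open>|f'|^q\<close> before Hoelder is applied, so that only continuous functions enter
    there.\<close>
  define G where "G = (\<lambda>x. a * (b - x) / (x * (b - a)) * \<bar>f' a\<bar> powr q
    + b * (x - a) / (x * (b - a)) * \<bar>f' b\<bar> powr q)"
  have "{a..b} \<subseteq> I"
    using assms(1,4,5) by (meson atLeastAtMost_iff is_interval_1 subsetI)
  then have parts: "((\<lambda>x. f' x * w x) has_integral d * ((f a + f b) / 2) - J) {a..b}"
    unfolding w_def d_def J_def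
    by (intro trapezoid_parts_inverse_square ab) (metis DERIV_subset assms(7))
  have contw: "continuous_on {a..b} w"
    unfolding w_def using ab by (auto intro!: continuous_intros)
  have contG: "continuous_on {a..b} G"
    unfolding G_def using ab by (auto intro!: continuous_intros)
  have G0: "G x \<ge> 0" if "x \<in> {a..b}" for x
    using ab that by (auto simp: G_def)
  have f'G: "\<bar>f' x\<bar> \<le> G x powr (1 / q)" if "x \<in> {a..b}" for x
  proof -
    have "\<bar>f' x\<bar> = (\<bar>f' x\<bar> powr q) powr (1 / q)"
      using \<open>q > 1\<close> by (simp add: powr_powr)
    also have "\<dots> \<le> G x powr (1 / q)"
      using harmonically_convex_on_endpoint_bound[OF assms(11) ab that] \<open>q > 1\<close>
      unfolding G_def by (intro powr_mono2) auto
    finally show ?thesis .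
  qed
  \<comment> \<open>The powers of \<open>x\<close> cancel in \<open>u * v\<close> and distribute the
    measure \<open>dx / x^2\<close>: \<open>u^p\<close> receives \<open>1 / x^2\<close>, while
    \<open>v^q\<close> receives \<open>x^(2q/p) = x^(2q-2)\<close>, the weight in the integrals for
    \<open>mu1\<close> and \<open>mu2\<close>.\<close>
  define u where "u = (\<lambda>x. \<bar>w x\<bar> * x powr (- 2 / p))"
  define v where "v = (\<lambda>x. G x powr (1 / q) * x powr (2 / p))"
  have contu: "continuous_on {a..b} u"
    unfolding u_def using ab by (auto intro!: continuous_intros contw)
  have contv: "continuous_on {a..b} v"
    unfolding v_def using ab \<open>q > 1\<close> G0
    by (intro continuous_on_mult continuous_on_powr' contG continuous_intros) auto
  have up: "u x powr p = \<bar>w x\<bar> powr p / x\<^sup>2" and vq: "v x powr q = G x * x powr (2 * q - 2)"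
    and uv: "u x * v x = \<bar>w x\<bar> * G x powr (1 / q)" if "x \<in> {a..b}" for x
  proof -
    have "x > 0" using ab that by auto
    then show "u x powr p = \<bar>w x\<bar> powr p / x\<^sup>2"
      using \<open>p > 1\<close> by (simp add: u_def powr_divide powr_powr powr_minus_divide)
    have "2 / p * q = 2 * q - 2" using arg_cong[OF qp, of "\<lambda>y. 2 * y"] by simp
    then show "v x powr q = G x * x powr (2 * q - 2)"
      using \<open>q > 1\<close> G0[OF that] by (simp add: v_def powr_mult powr_powr)
    show "u x * v x = \<bar>w x\<bar> * G x powr (1 / q)"
      using \<open>x > 0\<close> by (simp add: u_def v_def powr_minus field_simps)
  qed
  have P: "integral {a..b} (\<lambda>x. u x powr p) = d * (d / 2) powr p / (p + 1)"
  proof -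
    have "integral {a..b} (\<lambda>x. u x powr p) = integral {a..b} (\<lambda>x. \<bar>w x\<bar> powr p / x\<^sup>2)"
      by (intro integral_cong up)
    also have "\<dots> = d * (d / 2) powr p / (p + 1)"
      using has_integral_abs_weight_powr[OF ab, of p] \<open>p > 1\<close>
      by (intro integral_unique) (simp add: w_def d_def mult_ac)
    finally show ?thesis .
  qed
  have Q: "integral {a..b} (\<lambda>x. v x powr q) = d * (a * b) powr (2 * q) * M"
  proof -
    have "integral {a..b} (\<lambda>x. v x powr q) = integral {a..b} (\<lambda>x. G x * x powr (2 * q - 2))"
      by (intro integral_cong vq)
    also have "\<dots> = d * (a * b) powr (2 * q) * M"
      using has_integral_add[OF
          has_integral_mult_left[OF has_integral_mu1[OF ab \<open>q > 1\<close>], of "\<bar>f' a\<bar> powr q"]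
          has_integral_mult_left[OF has_integral_mu2[OF ab \<open>q > 1\<close>], of "\<bar>f' b\<bar> powr q"]]
      unfolding d_def[symmetric]
      by (intro integral_unique) (simp add: G_def M_def algebra_simps)
    finally show ?thesis .
  qed
  have "\<bar>d * ((f a + f b) / 2) - J\<bar> = norm (integral {a..b} (\<lambda>x. f' x * w x))"
    using integral_unique[OF parts] by simp
  also have "\<dots> \<le> integral {a..b} (\<lambda>x. u x * v x)"
  proof (rule integral_norm_bound_integral)
    show "(\<lambda>x. f' x * w x) integrable_on {a..b}"
      using parts by (rule has_integral_integrable)
    show "(\<lambda>x. u x * v x) integrable_on {a..b}"
      by (intro integrable_continuous_real continuous_on_mult contu contv)
    fix x assume x: "x \<in> {a..b}"
    show "norm (f' x * w x) \<le> u x * v x"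
      using mult_right_mono[OF f'G[OF x], of "\<bar>w x\<bar>"] by (simp add: uv[OF x] abs_mult mult.commute)
  qed
  also have "\<dots> \<le> (d * (d / 2) powr p / (p + 1)) powr (1 / p) * (d * (a * b) powr (2 * q) * M) powr (1 / q)"
    unfolding P[symmetric] Q[symmetric]
    by (rule Holder_continuous_on[OF ab(2) contu contv _ _ \<open>p > 1\<close> \<open>q > 1\<close> assms(10)])
      (auto simp: u_def v_def)
  \<comment> \<open>The factors \<open>d\<close> under the two roots are collected into one power,
    whose exponent is 1; the root of \<open>(d / 2)^p\<close> gives \<open>d / 2\<close>, and that
    of \<open>(a * b)^(2q)\<close> gives \<open>(a * b)^2\<close>.\<close>
  also have "\<dots> = d powr (1 / p + 1 / q) * (d / 2 * (1 / (p + 1)) powr (1 / p)) * ((a * b)\<^sup>2 * M powr (1 / q))"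
    using \<open>d > 0\<close> \<open>p > 1\<close> \<open>q > 1\<close> ab
    by (simp add: powr_mult powr_divide powr_powr powr_add power_mult_distrib)
  also have "\<dots> = d * (a * b * (b - a) / 2 * (1 / (p + 1)) powr (1 / p) * M powr (1 / q))"
    using \<open>d > 0\<close> ab by (simp add: assms(10)) (simp add: d_def power2_eq_square)
  finally have "\<bar>d * ((f a + f b) / 2) - J\<bar>
      \<le> d * (a * b * (b - a) / 2 * (1 / (p + 1)) powr (1 / p) * M powr (1 / q))" .
  moreover have "d * ((f a + f b) / 2) - J = d * ((f a + f b) / 2 - a * b / (b - a) * J)"
    using ab by (simp add: d_def right_diff_distrib)
  ultimately show ?thesis
    using \<open>d > 0\<close> by (simp add: abs_mult J_def M_def)
qed

end
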